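(* Let $f(x)\in\mathbb{Z}[x]$ be monic with $\deg f(x)=n>m$, where $m$ is a positive integer, and let $q_1,\dots,q_m\in\mathbb{Z}$. Then the equation $$(y+q_1)(y+q_2)\cdots(y+q_m)=f(x)$$ has finitely many solutions $(x,y)$ in integers if and only if $|x-y|$ is bounded for all integer solutions $(x,y)$, i.e. there is a constant $C$ such that $|x-y|\le C$ for every integer solution $(x,y)$ of the equation. *)

theory Defs
  imports Complex_Main "HOL-Computational_Algebra.Polynomial"
begin

end

theory Submission
  imports Defs
begin

text \<open>
  If \<open>y - x\<close> is bounded, it takes only finitely many values \<open>k\<close>. For each of them, substituting
  \<open>y = x + k\<close> turns the equation into a polynomial equation in \<open>x\<close> alone whose left-hand side
  has degree at most \<open>m\<close>, less than \<open>degree f\<close>; hence it is nontrivial and has finitely many roots.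
\<close>

lemma finite_solutions_poly_eq:
  fixes p f :: "'a::idom poly"
  assumes "p \<noteq> f"
  shows "finite {x. poly p x = poly f x}"
  using poly_roots_finite[of "p - f"] assms by simp

lemma degree_prod_linear_le:
  fixes a :: "'b \<Rightarrow> 'a::comm_semiring_1"
  assumes "finite A"
  shows "degree (\<Prod>i\<in>A. [:a i, 1:]) \<le> card A"
proof -
  have "degree (\<Prod>i\<in>A. [:a i, 1:]) \<le> (\<Sum>i\<in>A. degree [:a i, 1:])"
    using degree_prod_sum_le[OF assms, of "\<lambda>i. [:a i, 1:]"] by (simp add: o_def)
  also have "\<dots> \<le> (\<Sum>i\<in>A. 1)"
    by (intro sum_mono) (simp add: degree_pCons_le)
  finally show ?thesis by simp
qed

text \<open>For fixed \<open>k\<close> the product is the value at \<open>x\<close> of a polynomial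
  with linear factors \<open>[:k + q i, 1:]\<close>. Its degree is at most \<open>card A\<close>, so
  it cannot be \<open>f\<close>, and over an integral domain the nonzero difference has finitely
  many roots.\<close>

lemma finite_shifted_solutions:
  fixes f :: "'a::idom poly" and q :: "'b \<Rightarrow> 'a"
  assumes "finite A" "card A < degree f"
  shows "finite {x. (\<Prod>i\<in>A. (x + k + q i)) = poly f x}"
proof -
  have "(\<Prod>i\<in>A. [:k + q i, 1:]) \<noteq> f"
    using degree_prod_linear_le[OF assms(1), of "\<lambda>i. k + q i"] assms(2) by auto
  from finite_solutions_poly_eq[OF this] show ?thesis
    by (simp add: poly_prod add_ac)
qed

theorem theorem1p1:
  fixes f :: "int poly" and n m :: nat and q :: "nat \<Rightarrow> int"
  assumes monic: "lead_coeff f = 1"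
    and deg: "degree f = n"
    and n_gt_m: "n > m"
    and m_pos: "m > 0"
  shows "finite {(x :: int, y :: int). (\<Prod>i = 1..m. (y + q i)) = poly f x}
    \<longleftrightarrow> (\<exists>C :: real. \<forall>x y :: int.
          (\<Prod>i = 1..m. (y + q i)) = poly f x \<longrightarrow> real_of_int \<bar>x - y\<bar> \<le> C)"
    (is "finite ?S \<longleftrightarrow> ?bounded")
proof
  assume "finite ?S"
  then have fin: "finite ((\<lambda>(x, y). real_of_int \<bar>x - y\<bar>) ` ?S)" (is "finite ?D")
    by (rule finite_imageI)
  show ?bounded
  \<comment> \<open>If there are no solutions, \<open>Max ?D\<close> is an unspecified real, but
    then the bound holds vacuously.\<close>
  proof (intro exI[of _ "Max ?D"] allI impI)
    fix x y :: int
    assume "(\<Prod>i = 1..m. (y + q i)) = poly f x"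
    then have "real_of_int \<bar>x - y\<bar> \<in> ?D" by (intro image_eqI[of _ _ "(x, y)"]) auto
    with fin show "real_of_int \<bar>x - y\<bar> \<le> Max ?D" by (rule Max_ge)
  qed
next
  assume ?bounded
  then obtain C :: real where C: "\<And>x y :: int. (\<Prod>i = 1..m. (y + q i)) = poly f x
      \<Longrightarrow> real_of_int \<bar>x - y\<bar> \<le> C"
    by blast
  \<comment> \<open>\<open>R k\<close> holds the x-coordinates of the solutions on the line
    \<open>y = x + k\<close>.\<close>
  define R where "R k = {x. (\<Prod>i = 1..m. (x + k + q i)) = poly f x}" for k
  have "finite (R k)" for k
    unfolding R_def using deg n_gt_m by (intro finite_shifted_solutions) auto
  then have "finite (\<Union>k\<in>{-\<lfloor>C\<rfloor>..\<lfloor>C\<rfloor>}. (\<lambda>x. (x, x + k)) ` R k)"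
    by blast
  moreover have "?S \<subseteq> (\<Union>k\<in>{-\<lfloor>C\<rfloor>..\<lfloor>C\<rfloor>}. (\<lambda>x. (x, x + k)) ` R k)"
  proof clarify
    fix x y :: int
    assume sol: "(\<Prod>i = 1..m. (y + q i)) = poly f x"
    \<comment> \<open>The distance is an integer, so the real bound \<open>C\<close> can be rounded
      down. This leaves finitely many integer shifts \<open>k = y - x\<close>.\<close>
    then have "\<bar>x - y\<bar> \<le> \<lfloor>C\<rfloor>" using C le_floor_iff by blast
    then have "y - x \<in> {-\<lfloor>C\<rfloor>..\<lfloor>C\<rfloor>}" by auto
    moreover have "x \<in> R (y - x)" using sol by (simp add: R_def)
    ultimately show "(x, y) \<in> (\<Union>k\<in>{-\<lfloor>C\<rfloor>..\<lfloor>C\<rfloor>}. (\<lambda>x. (x, x + k)) ` R k)"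
      by force
  qed
  ultimately show "finite ?S" by (rule rev_finite_subset)
qed

end
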